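(* Let $f:\mathbb{R}^n\to\mathbb{R}$ be differentiable with $\|\nabla f(x)-\nabla f(y)\|\le L\|x-y\|$ for all $x,y\in\mathbb{R}^n$, where $L>0$. Let $D\subset\mathbb{R}^n$ be a finite set of unit-norm vectors forming a positive spanning set, with cosine measure $\mu$. Let $x_0\in\mathbb{R}^n$, $\alpha_0>0$, $c>0$. Then the iterates $x_k$, $k\ge 1$, of Simplified Direct Search (SDS) with input $(x_0,\alpha_0,c,D)$ satisfy $$\|\nabla f(x_k)\|\le \frac{\left(\frac L2+c\right)\alpha_0}{\mu 2^k}.$$ Pick any $0<\epsilon<\left(\frac L2+c\right)\frac{\alpha_0}{\mu}$. If, moreover, $f$ is bounded below, with $f^*=\inf_{x\in\mathbb{R}^n} f(x)>-\infty$, and $$k(\epsilon)=\left\lceil \log_2\left(\frac{(\frac L2+c)\alpha_0}{\mu\epsilon}\right)\right\rceil,$$ then $\|\nabla f(x_{k(\epsilon)})\|\le\epsilon$, while the method performs, up to iteration $k(\epsilon)$, in total at most $N(k(\epsilon))$ function evaluations, where $$N(k(\epsilon))\le 1+|D|\left(k(\epsilon)+\frac{16\,(f(x_0)-f^* )\left(\frac L2+c\right)^2}{3c\mu^2\epsilon^2}\right).$$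
   Context: $\langle\cdot,\cdot\rangle$ and $\|\cdot\|$ are the standard Euclidean inner product and norm on $\mathbb{R}^n$. A finite set $D\subset\mathbb{R}^n$ is a positive spanning set if its conic hull $\{\sum_i t_i d_i: d_i\in D,\ t_i\ge 0\}$ equals $\mathbb{R}^n$. The cosine measure of $D$ is $\mu=\min_{0\ne v\in\mathbb{R}^n}\max_{d\in D}\frac{\langle v,d\rangle}{\|v\|\|d\|}$; it is positive for a positive spanning set of nonzero vectors. Simplified Direct Search (SDS). Input: $x_0\in\mathbb{R}^n$, $\alpha_0>0$, forcing constant $c>0$, finite set $D\subset\mathbb{R}^n$. For $k=1,2,\dots$: set $x_k^0=x_{k-1}$ and $\alpha_k=\frac12\alpha_{k-1}$ (so $\alpha_k=\alpha_0/2^k$); starting from $l=0$, while there exists $d\in D$ with $f(x_k^l+\alpha_k d)\le f(x_k^l)-c\alpha_k^2$, pick any such $d$, call it $d_k^l$, set $x_k^{l+1}=x_k^l+\alpha_k d_k^l$ and increase $l$ by one. Let $l_k$ be the value of $l$ when this inner loop stops (i.e. $f(x_k^{l_k}+\alpha_k d)>f(x_k^{l_k})-c\alpha_k^2$ for all $d\in D$), and set $x_k=x_k^{l_k}$. The choice of $d$ among those satisfying the decrease condition is arbitrary, and the statement holds for every such choice. The iterates are the points $x_k$ that the method produces (if some inner loop never terminates, no further iterates are produced). Cost model: computing $f(x_0)$ costs one evaluation; given the value of $f$ at the current point, finding a direction satisfying the decrease condition, or verifying that there is none, costs at most $|D|$ evaluations. Thus iteration $j$ costs at most $|D|(l_j+1)$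 evaluations, and the total up to iteration $k$ is at most $N(k)=1+\sum_{j=1}^k|D|(l_j+1)$. *)

theory Defs
  imports "HOL-Analysis.Analysis" "HOL-Library.Extended_Nat"
begin

definition gradient :: "(real ^ 'n \<Rightarrow> real) \<Rightarrow> real ^ 'n \<Rightarrow> real ^ 'n" where
  "gradient f x = (THE g. GDERIV f x :> g)"

(* The library's conic hull only closes under nonnegative scaling, not under sums,
   so it is not the hull meant here. *)
definition positive_spanning_set :: "(real ^ 'n) set \<Rightarrow> bool" where
  "positive_spanning_set D \<longleftrightarrow>
     finite D \<and> {\<Sum>d\<in>D. t d *\<^sub>R d | t. \<forall>d\<in>D. 0 \<le> t d} = UNIV"

(* LEAST expresses the minimum over all nonzero v; it is attained for finite nonempty D,
   because the ratio depends only on v / norm v and the unit sphere is compact. *)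
definition cosine_measure :: "(real ^ 'n) set \<Rightarrow> real" where
  "cosine_measure D =
     (LEAST r. \<exists>v. v \<noteq> 0 \<and> r = Max ((\<lambda>d. (v \<bullet> d) / (norm v * norm d)) ` D))"

primrec step_size :: "real \<Rightarrow> nat \<Rightarrow> real" where
  "step_size \<alpha>0 0 = \<alpha>0"
| "step_size \<alpha>0 (Suc k) = (1 / 2) * step_size \<alpha>0 k"

definition sufficient_decrease ::
  "(real ^ 'n \<Rightarrow> real) \<Rightarrow> real \<Rightarrow> real \<Rightarrow> real ^ 'n \<Rightarrow> real ^ 'n \<Rightarrow> bool" where
  "sufficient_decrease f c \<alpha> x d \<longleftrightarrow> f (x + \<alpha> *\<^sub>R d) \<le> f x - c * \<alpha>\<^sup>2"

(* An execution is described by the inner points x k i, the chosen directions d k i and the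
   numbers l k of inner steps; l k = \<infinity> means that the inner loop of iteration k does not
   terminate. Values of x, d, l at iterations that are never started are irrelevant. *)

definition sds_produces :: "(nat \<Rightarrow> enat) \<Rightarrow> nat \<Rightarrow> bool" where
  "sds_produces l k \<longleftrightarrow> (\<forall>j\<in>{1..k}. l j \<noteq> \<infinity>)"

(* Only meaningful if sds_produces l k. *)
definition sds_iterate ::
  "real ^ 'n \<Rightarrow> (nat \<Rightarrow> nat \<Rightarrow> real ^ 'n) \<Rightarrow> (nat \<Rightarrow> enat) \<Rightarrow> nat \<Rightarrow> real ^ 'n" where
  "sds_iterate x0 x l k = (if k = 0 then x0 else x k (the_enat (l k)))"

definition sds_run ::
  "(real ^ 'n \<Rightarrow> real) \<Rightarrow> real ^ 'n \<Rightarrow> real \<Rightarrow> real \<Rightarrow> (real ^ 'n) set \<Rightarrow>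
   (nat \<Rightarrow> nat \<Rightarrow> real ^ 'n) \<Rightarrow> (nat \<Rightarrow> nat \<Rightarrow> real ^ 'n) \<Rightarrow> (nat \<Rightarrow> enat) \<Rightarrow> bool" where
  "sds_run f x0 \<alpha>0 c D x d l \<longleftrightarrow>
     (\<forall>k\<ge>1. sds_produces l (k - 1) \<longrightarrow>
        x k 0 = sds_iterate x0 x l (k - 1) \<and>
        (\<forall>i. enat i < l k \<longrightarrow>
           d k i \<in> D \<and>
           sufficient_decrease f c (step_size \<alpha>0 k) (x k i) (d k i) \<and>
           x k (Suc i) = x k i + step_size \<alpha>0 k *\<^sub>R d k i) \<and>
        (\<forall>i. l k = enat i \<longrightarrow>
           \<not> (\<exists>b\<in>D. sufficient_decrease f c (step_size \<alpha>0 k) (x k i) b)))"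

(* e k i is the number of evaluations spent at the point x k i on finding the next direction
   (i < l k) or on verifying that there is none (i = l k). *)
definition sds_poll_costs ::
  "(real ^ 'n) set \<Rightarrow> (nat \<Rightarrow> enat) \<Rightarrow> (nat \<Rightarrow> nat \<Rightarrow> nat) \<Rightarrow> bool" where
  "sds_poll_costs D l e \<longleftrightarrow>
     (\<forall>k\<ge>1. sds_produces l (k - 1) \<longrightarrow> (\<forall>i. enat i \<le> l k \<longrightarrow> e k i \<le> card D))"

(* The leading 1 in the next two definitions accounts for f x0. *)
definition sds_evaluations :: "(nat \<Rightarrow> enat) \<Rightarrow> (nat \<Rightarrow> nat \<Rightarrow> nat) \<Rightarrow> nat \<Rightarrow> nat" where
  "sds_evaluations l e k = 1 + (\<Sum>j=1..k. \<Sum>i\<le>the_enat (l j). e j i)"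

definition sds_evaluation_bound :: "(real ^ 'n) set \<Rightarrow> (nat \<Rightarrow> enat) \<Rightarrow> nat \<Rightarrow> nat" where
  "sds_evaluation_bound D l k = 1 + (\<Sum>j=1..k. card D * (the_enat (l j) + 1))"

end

(* At a point where polling fails with step size alpha, the descent lemma gives
   <-grad f, b> < (L/2 + c) alpha for every b in D, while some b in D makes an angle with
   -grad f whose cosine is at least mu; hence mu |grad f| <= (L/2 + c) alpha.
   Every inner step of iteration j lowers f by at least c alpha_0^2 / 4^j. Summing up,
   the total number of inner steps up to iteration k is at most
   4^k (f x0 - fstar) / (c alpha_0^2). For k = k(eps), 2^k is less than twice the argument
   of the logarithm defining k(eps), so the bound holds with 4 in place of 16/3. *)
theory Submission
  imports Defs
begin

section \<open>Gradients and the descent lemma\<close>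

lemma GDERIV_gradient:
  assumes "f differentiable (at x)"
  shows "GDERIV f x :> gradient f x"
proof -
  obtain f' where f': "(f has_derivative f') (at x)"
    using assms unfolding differentiable_def by blast
  then interpret bounded_linear f' by (rule has_derivative_bounded_linear)
  \<comment> \<open>Riesz representation in coordinates: the representing vector collects the values
    of the linear map \<open>f'\<close> on the basis.\<close>
  have "f' h = h \<bullet> (\<Sum>b\<in>Basis. f' b *\<^sub>R b)" for h
  proof -
    have "f' h = f' (\<Sum>b\<in>Basis. (h \<bullet> b) *\<^sub>R b)"
      by (simp add: euclidean_representation)
    then show ?thesis by (simp add: sum scaleR inner_sum_right mult.commute)
  qed
  then have "f' = (\<lambda>h. h \<bullet> (\<Sum>b\<in>Basis. f' b *\<^sub>R b))" by (rule ext)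
  with f' obtain g where g: "GDERIV f x :> g" unfolding gderiv_def by metis
  \<comment> \<open>Uniqueness is what lets the description operator in \<open>gradient\<close>
    select g: a vector is determined by its inner products with all u.\<close>
  have "h = g" if "GDERIV f x :> h" for h
  proof -
    have "(\<lambda>u. u \<bullet> h) = (\<lambda>u. u \<bullet> g)"
      using that g unfolding gderiv_def by (rule has_derivative_unique)
    then have "\<forall>u. u \<bullet> h = u \<bullet> g" by (rule fun_cong[THEN allI])
    then show ?thesis by (simp only: vector_eq_ldot)
  qed
  then have "gradient f x = g"
    unfolding gradient_def by (intro the_equality[where P = "\<lambda>g. GDERIV f x :> g"] g)
  then show ?thesis using g by simp
qed

text \<open>Monotonicity replaces integration along the segment: \<phi> is f minus the linear and
  quadratic terms of the bound, and Cauchy-Schwarz with the Lipschitz condition makes its derivative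
  nonpositive on [0, 1].\<close>

lemma descent_lemma:
  fixes f :: "'a::real_inner \<Rightarrow> real"
  assumes grad: "\<And>y. GDERIV f y :> g y"
    and lipschitz: "\<And>y z. norm (g y - g z) \<le> L * norm (y - z)"
  shows "f (y + h) \<le> f y + h \<bullet> g y + L / 2 * (norm h)\<^sup>2"
proof -
  define \<phi> where "\<phi> t = f (y + t *\<^sub>R h) - t * (h \<bullet> g y) - L / 2 * t\<^sup>2 * (norm h)\<^sup>2" for t
  have deriv: "(\<phi> has_real_derivative h \<bullet> (g (y + t *\<^sub>R h) - g y) - L * t * (norm h)\<^sup>2) (at t)" for t
  proof -
    have "((\<lambda>t. f (y + t *\<^sub>R h)) has_derivative (\<lambda>s. (s *\<^sub>R h) \<bullet> g (y + t *\<^sub>R h))) (at t)"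
      by (rule has_derivative_compose[OF _ grad[unfolded gderiv_def]])
        (auto intro!: derivative_eq_intros)
    then have "((\<lambda>t. f (y + t *\<^sub>R h)) has_real_derivative h \<bullet> g (y + t *\<^sub>R h)) (at t)"
      by (simp add: has_field_derivative_def mult.commute[of _ "h \<bullet> _"] cong: if_cong)
    then show ?thesis unfolding \<phi>_def
      by (auto intro!: derivative_eq_intros simp: inner_diff_right)
  qed
  have "\<phi> 1 \<le> \<phi> 0"
  proof (rule DERIV_nonpos_imp_nonincreasing[of 0 1 \<phi>])
    fix t :: real assume "0 \<le> t" "t \<le> 1"
    have "h \<bullet> (g (y + t *\<^sub>R h) - g y) \<le> norm h * norm (g (y + t *\<^sub>R h) - g y)"
      by (rule norm_cauchy_schwarz)
    also have "\<dots> \<le> norm h * (L * norm (y + t *\<^sub>R h - y))"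
      by (intro mult_left_mono lipschitz) simp
    also have "\<dots> = L * t * (norm h)\<^sup>2"
      using \<open>0 \<le> t\<close> by (simp add: power2_eq_square)
    finally show "\<exists>D. DERIV \<phi> t :> D \<and> D \<le> 0" using deriv by force
  qed simp
  then show ?thesis by (simp add: \<phi>_def)
qed

section \<open>Positive spanning sets and the cosine measure\<close>

lemma positive_spanning_set_inner_pos:
  assumes "positive_spanning_set D" "v \<noteq> 0"
  obtains b where "b \<in> D" "0 < v \<bullet> b"
proof -
  have "v \<in> {\<Sum>d\<in>D. t d *\<^sub>R d | t. \<forall>d\<in>D. 0 \<le> t d}"
    using assms(1) unfolding positive_spanning_set_def by blast
  then obtain t where t: "v = (\<Sum>d\<in>D. t d *\<^sub>R d)" "\<forall>d\<in>D. 0 \<le> t d" by blast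
  \<comment> \<open>The left factor and the sum are both v. A positive sum has a positive term, and
    \<open>0 \<le> t d\<close> then forces \<open>v \<bullet> d\<close> to be positive.\<close>
  have "0 < v \<bullet> (\<Sum>d\<in>D. t d *\<^sub>R d)" using t(1) assms(2) by auto
  also have "\<dots> = (\<Sum>d\<in>D. t d * (v \<bullet> d))" by (simp add: inner_sum_right)
  finally obtain d where "d \<in> D" "0 < t d * (v \<bullet> d)"
    using sum_nonpos[of D "\<lambda>d. t d * (v \<bullet> d)"] by force
  then show thesis using that t(2) by (auto simp: zero_less_mult_iff)
qed

lemma continuous_on_Max_image:
  fixes g :: "'b \<Rightarrow> 'a::topological_space \<Rightarrow> 'c::linorder_topology"
  assumes "finite I" "I \<noteq> {}" "\<And>i. i \<in> I \<Longrightarrow> continuous_on S (g i)"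
  shows "continuous_on S (\<lambda>x. Max ((\<lambda>i. g i x) ` I))"
  using assms by (induction rule: finite_ne_induct) (auto intro!: continuous_on_max)

text \<open>\<open>LEAST\<close> on the reals yields nothing until a minimum is exhibited.
  Attainment serves the positivity of the measure, the lower bound serves the choice of a good poll
  direction.\<close>

lemma cosine_measure_attained:
  fixes D :: "(real ^ 'n) set"
  assumes "finite D" "D \<noteq> {}"
  shows "\<exists>u. u \<noteq> 0 \<and> cosine_measure D = Max ((\<lambda>d. (u \<bullet> d) / (norm u * norm d)) ` D)"
    and "v \<noteq> 0 \<Longrightarrow> cosine_measure D \<le> Max ((\<lambda>d. (v \<bullet> d) / (norm v * norm d)) ` D)"
proof -
  define m where "m v = Max ((\<lambda>d. (v \<bullet> d) / (norm v * norm d)) ` D)" for v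
  \<comment> \<open>Scale invariance carries the minimum on the unit sphere over to all nonzero
    vectors.\<close>
  have m_sgn: "m (sgn v) = m v" if "v \<noteq> 0" for v
    using that by (simp add: m_def sgn_div_norm divide_inverse mult.assoc mult.left_commute)
  have "continuous_on (sphere 0 1) m"
    unfolding m_def using assms
    by (intro continuous_on_Max_image)
      (auto simp: continuous_on_eq_continuous_within divide_inverse intro!: continuous_intros)
  moreover have "sphere (0 :: real ^ 'n) 1 \<noteq> {}" by simp
  ultimately obtain u where u: "u \<in> sphere 0 1" and min: "\<And>v. v \<in> sphere 0 1 \<Longrightarrow> m u \<le> m v"
    using continuous_attains_inf[OF compact_sphere] by blast
  have le: "m u \<le> m v" if "v \<noteq> 0" for v
    using min[of "sgn v"] that by (simp add: m_sgn norm_sgn)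
  have "u \<noteq> 0" using u by auto
  have "cosine_measure D = m u"
    unfolding cosine_measure_def m_def[symmetric]
    by (rule Least_equality) (use le \<open>u \<noteq> 0\<close> in auto)
  then show "\<exists>u. u \<noteq> 0 \<and> cosine_measure D = Max ((\<lambda>d. (u \<bullet> d) / (norm u * norm d)) ` D)"
    and "v \<noteq> 0 \<Longrightarrow> cosine_measure D \<le> Max ((\<lambda>d. (v \<bullet> d) / (norm v * norm d)) ` D)"
    using \<open>u \<noteq> 0\<close> le unfolding m_def by simp_all (rule exI[of _ u], simp)
qed

lemma positive_spanning_set_nonempty:
  fixes D :: "(real ^ 'n) set"
  assumes "positive_spanning_set D"
  shows "D \<noteq> {}"
proof -
  \<comment> \<open>Index types are nonempty, so the dimension is at least one and the all-ones
    vector is a nonzero test vector.\<close>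
  have "(1 :: real ^ 'n) \<noteq> 0" by (simp add: vec_eq_iff)
  with assms show ?thesis by (metis empty_iff positive_spanning_set_inner_pos)
qed

text \<open>The minimum is attained at some u, and a positive spanning set contains a vector making
  an acute angle with that u. An infimum of positive values that is not attained could be 0.\<close>

lemma cosine_measure_pos:
  fixes D :: "(real ^ 'n) set"
  assumes "positive_spanning_set D"
  shows "0 < cosine_measure D"
proof -
  have fin: "finite D" using assms by (simp add: positive_spanning_set_def)
  obtain u where u: "u \<noteq> 0" "cosine_measure D = Max ((\<lambda>d. (u \<bullet> d) / (norm u * norm d)) ` D)"
    using cosine_measure_attained(1)[OF fin positive_spanning_set_nonempty[OF assms]] by blast
  obtain b where b: "b \<in> D" "0 < u \<bullet> b"
    using positive_spanning_set_inner_pos[OF assms u(1)] .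
  then have "0 < (u \<bullet> b) / (norm u * norm b)"
    using u(1) by (intro divide_pos_pos mult_pos_pos) auto
  also have "\<dots> \<le> cosine_measure D" unfolding u(2) using fin b(1) by simp
  finally show ?thesis .
qed

lemma cosine_measure_direction:
  fixes D :: "(real ^ 'n) set"
  assumes "finite D" "D \<noteq> {}" "\<And>b. b \<in> D \<Longrightarrow> norm b = 1"
  obtains b where "b \<in> D" "cosine_measure D * norm v \<le> v \<bullet> b"
proof (cases "v = 0")
  \<comment> \<open>The measure ranges over nonzero vectors only; for v = 0 both sides vanish and
    any element of D serves.\<close>
  case True
  then show thesis using assms(2) that by auto
next
  case False
  have "Max ((\<lambda>d. (v \<bullet> d) / (norm v * norm d)) ` D) \<in> (\<lambda>d. (v \<bullet> d) / (norm v * norm d)) ` D"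
    using assms by (intro Max_in) auto
  then obtain b where "b \<in> D" "cosine_measure D \<le> (v \<bullet> b) / norm v"
    using cosine_measure_attained(2)[OF assms(1,2) False] assms(3) by auto
  then show thesis using that False by (simp add: field_simps)
qed

section \<open>Gradient bound at an unsuccessful poll\<close>

lemma norm_gradient_le_at_unsuccessful_poll:
  fixes f :: "real ^ 'n \<Rightarrow> real"
  assumes "\<And>y. f differentiable (at y)"
    and "\<And>y z. norm (gradient f y - gradient f z) \<le> L * norm (y - z)"
    and D: "positive_spanning_set D" "\<And>b. b \<in> D \<Longrightarrow> norm b = 1"
    and "0 < \<alpha>"
    and fail: "\<And>b. b \<in> D \<Longrightarrow> \<not> sufficient_decrease f c \<alpha> y b"
  shows "norm (gradient f y) \<le> (L / 2 + c) * \<alpha> / cosine_measure D"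
proof -
  have "finite D" using D(1) by (simp add: positive_spanning_set_def)
  then obtain b where b: "b \<in> D" "cosine_measure D * norm (- gradient f y) \<le> (- gradient f y) \<bullet> b"
    using cosine_measure_direction positive_spanning_set_nonempty[OF D(1)] D(2) by metis
  have "f y - c * \<alpha>\<^sup>2 < f (y + \<alpha> *\<^sub>R b)"
    using fail[OF b(1)] by (simp add: sufficient_decrease_def)
  also have "\<dots> \<le> f y + (\<alpha> *\<^sub>R b) \<bullet> gradient f y + L / 2 * (norm (\<alpha> *\<^sub>R b))\<^sup>2"
    by (rule descent_lemma) (use assms(1,2) in \<open>auto intro: GDERIV_gradient\<close>)
  \<comment> \<open>The terms f y cancel, and \<open>norm b = 1\<close> turns the quadratic term
    into \<open>L / 2 * \<alpha>\<^sup>2\<close>, so a factor \<alpha> can be split off.\<close>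
  finally have "\<alpha> * (- gradient f y \<bullet> b) < \<alpha> * ((L / 2 + c) * \<alpha>)"
    using D(2)[OF b(1)] by (simp add: inner_commute power2_eq_square algebra_simps)
  then have "- gradient f y \<bullet> b < (L / 2 + c) * \<alpha>"
    using \<open>0 < \<alpha>\<close> mult_less_cancel_left_pos by blast
  then have "cosine_measure D * norm (gradient f y) \<le> (L / 2 + c) * \<alpha>" using b(2) by simp
  then show ?thesis using cosine_measure_pos[OF D(1)] by (simp add: field_simps)
qed

section \<open>Decrease and termination along a run\<close>

lemma step_size_eq: "step_size \<alpha>0 k = \<alpha>0 / 2 ^ k"
  by (induction k) auto

lemma sds_produces_Suc: "sds_produces l (Suc k) \<longleftrightarrow> sds_produces l k \<and> l (Suc k) \<noteq> \<infinity>"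
proof -
  have "{1..Suc k} = insert (Suc k) {1..k}" by (rule atLeastAtMostSuc_conv) simp
  then show ?thesis unfolding sds_produces_def by simp metis
qed

lemma sds_produces_finite:
  assumes "sds_produces l k" "1 \<le> j" "j \<le> k"
  obtains n where "l j = enat n"
proof -
  have "l j \<noteq> \<infinity>" using assms unfolding sds_produces_def by (meson atLeastAtMost_iff)
  then show thesis using that by (meson not_infinity_eq)
qed

lemma sds_produces_mono: "sds_produces l k \<Longrightarrow> j \<le> k \<Longrightarrow> sds_produces l j"
  by (simp add: sds_produces_def del: not_infinity_eq)

text \<open>Stated with \<open>enat i \<le> l (Suc k)\<close> so that it also covers a
  nonterminating inner loop, where it holds for every i; the termination proof relies on this
  case.\<close>

lemma sds_run_inner_decrease:
  assumes run: "sds_run f x0 \<alpha>0 c D x d l" and "sds_produces l k" "enat i \<le> l (Suc k)"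
  shows "f (x (Suc k) i) \<le> f (sds_iterate x0 x l k) - real i * (c * (step_size \<alpha>0 (Suc k))\<^sup>2)"
  using assms(3)
proof (induction i)
  case 0
  have "x (Suc k) 0 = sds_iterate x0 x l k"
    using run assms(2) unfolding sds_run_def by (metis diff_Suc_1 le_add1 plus_1_eq_Suc)
  then show ?case by simp
next
  case (Suc i)
  then have i: "enat i < l (Suc k)" by (simp add: Suc_ile_eq)
  have "sufficient_decrease f c (step_size \<alpha>0 (Suc k)) (x (Suc k) i) (d (Suc k) i) \<and>
      x (Suc k) (Suc i) = x (Suc k) i + step_size \<alpha>0 (Suc k) *\<^sub>R d (Suc k) i"
    using run assms(2) i unfolding sds_run_def by (metis diff_Suc_1 le_add1 plus_1_eq_Suc)
  then show ?case
    using Suc.IH[OF less_imp_le[OF i]] by (simp del: step_size.simps add: sufficient_decrease_def algebra_simps)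
qed

text \<open>An endless inner loop would subtract the same \<delta> > 0 arbitrarily often, and by the
  Archimedean property f would fall below B.\<close>

lemma sds_produces_of_bounded_below:
  assumes run: "sds_run f x0 \<alpha>0 c D x d l" and bdd: "\<And>y. B \<le> f y" and "0 < \<alpha>0" "0 < c"
  shows "sds_produces l k"
proof (induction k)
  case 0
  show ?case by (simp add: sds_produces_def)
next
  case (Suc k)
  define \<delta> where "\<delta> = c * (step_size \<alpha>0 (Suc k))\<^sup>2"
  have "0 < \<delta>" using assms(3,4) unfolding \<delta>_def step_size_eq by simp
  obtain i where i: "f (sds_iterate x0 x l k) - B < real i * \<delta>"
    using ex_less_of_nat_mult[OF \<open>0 < \<delta>\<close>] by blast
  have False if "l (Suc k) = \<infinity>"
    using sds_run_inner_decrease[OF run Suc, of i] bdd[of "x (Suc k) i"] i that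
    by (simp add: \<delta>_def)
  with Suc show ?case by (auto simp: sds_produces_Suc)
qed

text \<open>The decreases of the iterations telescope; the weights \<open>1 / 4 ^ j\<close> are the
  squares of the halved step sizes.\<close>

lemma sds_run_total_decrease:
  assumes run: "sds_run f x0 \<alpha>0 c D x d l" and "sds_produces l k"
  shows "f (sds_iterate x0 x l k) \<le>
    f x0 - c * \<alpha>0\<^sup>2 * (\<Sum>j=1..k. real (the_enat (l j)) / 4 ^ j)"
  using assms(2)
proof (induction k)
  case 0
  show ?case by (simp add: sds_iterate_def)
next
  case (Suc k)
  then have k: "sds_produces l k" and "l (Suc k) \<noteq> \<infinity>" by (auto simp: sds_produces_Suc)
  then obtain n where n: "l (Suc k) = enat n" by auto
  have "f (sds_iterate x0 x l (Suc k)) = f (x (Suc k) n)"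
    by (simp add: sds_iterate_def n)
  also have "\<dots> \<le> f (sds_iterate x0 x l k) - real n * (c * (step_size \<alpha>0 (Suc k))\<^sup>2)"
    using sds_run_inner_decrease[OF run k, of n] n by simp
  also have "(step_size \<alpha>0 (Suc k))\<^sup>2 = \<alpha>0\<^sup>2 / 4 ^ Suc k"
    by (simp only: step_size_eq power_divide power_mult[symmetric] mult.commute[of _ 2])
      (simp add: power_mult)
  finally show ?case using Suc.IH[OF k] n by (simp add: algebra_simps)
qed

text \<open>The total decrease bounds the weighted number of steps, and each weight is at least
  \<open>1 / 4 ^ k\<close>. Writing \<open>4 ^ k\<close> as \<open>(2 ^ k)\<^sup>2\<close> prepares
  for inserting a bound on \<open>2 ^ k\<close>.\<close>

lemma sds_run_total_steps:
  assumes run: "sds_run f x0 \<alpha>0 c D x d l" and "sds_produces l k"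
    and bdd: "\<And>y. B \<le> f y" and "0 < \<alpha>0" "0 < c"
  shows "(\<Sum>j=1..k. real (the_enat (l j))) \<le> (f x0 - B) * (2 ^ k)\<^sup>2 / (c * \<alpha>0\<^sup>2)"
proof -
  define S where "S = (\<Sum>j=1..k. real (the_enat (l j)) / 4 ^ j)"
  have "(\<Sum>j=1..k. real (the_enat (l j))) \<le> (\<Sum>j=1..k. 4 ^ k * (real (the_enat (l j)) / 4 ^ j))"
  proof (rule sum_mono)
    fix j assume "j \<in> {1..k}"
    then have "(4::real) ^ j \<le> 4 ^ k" by simp
    then have "real (the_enat (l j)) * 4 ^ j \<le> real (the_enat (l j)) * 4 ^ k"
      by (intro mult_left_mono) auto
    then show "real (the_enat (l j)) \<le> 4 ^ k * (real (the_enat (l j)) / 4 ^ j)"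
      by (simp add: field_simps)
  qed
  also have "\<dots> = (2 ^ k)\<^sup>2 * S"
    by (simp add: S_def sum_distrib_left power_mult[symmetric] mult.commute[of k 2])
      (simp add: power_mult)
  also have "\<dots> \<le> (2 ^ k)\<^sup>2 * ((f x0 - B) / (c * \<alpha>0\<^sup>2))"
  proof (rule mult_left_mono)
    have "B \<le> f x0 - c * \<alpha>0\<^sup>2 * S"
      using sds_run_total_decrease[OF run assms(2)] bdd order_trans unfolding S_def by blast
    then show "S \<le> (f x0 - B) / (c * \<alpha>0\<^sup>2)"
      using assms(4,5) by (simp add: field_simps)
  qed simp
  finally show ?thesis by (simp add: mult_ac)
qed

section \<open>Evaluation counts and the choice of k\<close>

lemma sds_evaluations_le_bound:
  assumes "sds_poll_costs D l e" "sds_produces l k"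
  shows "sds_evaluations l e k \<le> sds_evaluation_bound D l k"
proof -
  have "(\<Sum>i\<le>the_enat (l j). e j i) \<le> card D * (the_enat (l j) + 1)" if "j \<in> {1..k}" for j
  proof -
    have j: "1 \<le> j" "j \<le> k" using that by auto
    obtain n where n: "l j = enat n" using sds_produces_finite[OF assms(2) j] .
    \<comment> \<open>Poll costs are constrained only at iterations that are actually
      started.\<close>
    have "sds_produces l (j - 1)"
      by (rule sds_produces_mono[OF assms(2)]) (use j in simp)
    then have "e j i \<le> card D" if "i \<le> n" for i
      using assms(1) n that j unfolding sds_poll_costs_def by (metis enat_ord_simps(1))
    \<comment> \<open>The indices 0 to n give n + 1 polls: n successful ones and the final one that
      confirms failure.\<close>
    then have "(\<Sum>i\<le>n. e j i) \<le> (\<Sum>i\<le>n. card D)" by (intro sum_mono) auto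
    then show ?thesis by (simp add: n mult.commute)
  qed
  then show ?thesis
    unfolding sds_evaluations_def sds_evaluation_bound_def by (intro add_left_mono sum_mono)
qed

text \<open>Rounding the exponent up adds less than 1, hence multiplies the power by less than b.
  Since A > 1, the logarithm is positive and \<open>nat\<close> truncates nothing.\<close>

lemma power_nat_ceiling_log_bounds:
  assumes "1 < b" "1 < A"
  shows "A \<le> b ^ nat \<lceil>log b A\<rceil>" "b ^ nat \<lceil>log b A\<rceil> < b * A"
proof -
  define k where "k = nat \<lceil>log b A\<rceil>"
  have "0 < log b A" using assms by simp
  then have "log b A \<le> real k" "real k < log b A + 1"
    unfolding k_def by linarith+
  moreover have "log b A + 1 = log b (b * A)" using assms by (simp add: log_mult)
  ultimately have "A \<le> b powr real k" "b powr real k < b * A"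
    using assms by (auto simp: log_le_iff less_log_iff)
  then show "A \<le> b ^ nat \<lceil>log b A\<rceil>" "b ^ nat \<lceil>log b A\<rceil> < b * A"
    using assms by (simp_all add: powr_realpow flip: k_def)
qed

section \<open>Gradient rate and evaluation complexity\<close>

theorem theorem11:
  fixes f :: "real ^ 'n \<Rightarrow> real"
    and D :: "(real ^ 'n) set"
    and x0 :: "real ^ 'n"
    and L c \<alpha>0 \<mu> :: real
    and x d :: "nat \<Rightarrow> nat \<Rightarrow> real ^ 'n"
    and l :: "nat \<Rightarrow> enat"
    and e :: "nat \<Rightarrow> nat \<Rightarrow> nat"
  assumes "\<And>y. f differentiable (at y)"
    and "L > 0"
    and "\<And>y z. norm (gradient f y - gradient f z) \<le> L * norm (y - z)"
    and "finite D"
    and "\<And>b. b \<in> D \<Longrightarrow> norm b = 1"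
    and "positive_spanning_set D"
    and "\<mu> = cosine_measure D"
    and "\<alpha>0 > 0"
    and "c > 0"
    and "sds_run f x0 \<alpha>0 c D x d l"
    and "sds_poll_costs D l e"
  shows "(\<forall>k\<ge>1. sds_produces l k \<longrightarrow>
            norm (gradient f (sds_iterate x0 x l k)) \<le> (L / 2 + c) * \<alpha>0 / (\<mu> * 2 ^ k)) \<and>
         (\<forall>\<epsilon> fstar k. 0 < \<epsilon> \<and> \<epsilon> < (L / 2 + c) * (\<alpha>0 / \<mu>) \<and>
            bdd_below (range f) \<and> fstar = (INF y. f y) \<and>
            k = nat \<lceil>log 2 ((L / 2 + c) * \<alpha>0 / (\<mu> * \<epsilon>))\<rceil> \<longrightarrow>
              sds_produces l k \<and>
              norm (gradient f (sds_iterate x0 x l k)) \<le> \<epsilon> \<and>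
              sds_evaluations l e k \<le> sds_evaluation_bound D l k \<and>
              real (sds_evaluation_bound D l k) \<le>
                1 + real (card D) *
                  (real k + 16 * (f x0 - fstar) * (L / 2 + c)\<^sup>2 / (3 * c * \<mu>\<^sup>2 * \<epsilon>\<^sup>2)))"
proof (intro conjI allI impI)
  have \<mu>: "0 < \<mu>" using cosine_measure_pos assms by blast
  show grad: "norm (gradient f (sds_iterate x0 x l k)) \<le> (L / 2 + c) * \<alpha>0 / (\<mu> * 2 ^ k)"
    if k: "1 \<le> k" "sds_produces l k" for k
  proof -
    obtain n where n: "l k = enat n"
      using sds_produces_finite[OF k(2,1) order_refl] .
    have "sds_produces l (k - 1)" by (rule sds_produces_mono[OF k(2)]) simp
    then have "\<not> sufficient_decrease f c (step_size \<alpha>0 k) (x k n) b" if "b \<in> D" for b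
      using assms(10) k(1) n that unfolding sds_run_def by metis
    then have "norm (gradient f (x k n)) \<le> (L / 2 + c) * step_size \<alpha>0 k / \<mu>"
      unfolding assms(7) using assms
      by (intro norm_gradient_le_at_unsuccessful_poll) (auto simp: step_size_eq)
    then show ?thesis
      using k(1) n by (simp add: sds_iterate_def step_size_eq mult.commute)
  qed
  fix \<epsilon> fstar k
  define K where "K = L / 2 + c"
  define A where "A = K * \<alpha>0 / (\<mu> * \<epsilon>)"
  assume H: "0 < \<epsilon> \<and> \<epsilon> < (L / 2 + c) * (\<alpha>0 / \<mu>) \<and> bdd_below (range f) \<and> fstar = (INF y. f y) \<and>
            k = nat \<lceil>log 2 ((L / 2 + c) * \<alpha>0 / (\<mu> * \<epsilon>))\<rceil>"
  have K: "0 < K" using assms by (simp add: K_def)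
  \<comment> \<open>The upper bound imposed on \<epsilon> says exactly this.\<close>
  have A: "1 < A" using H \<mu> by (simp add: A_def K_def field_simps)
  have k: "k = nat \<lceil>log 2 A\<rceil>" using H by (simp add: A_def K_def)
  have pow: "A \<le> 2 ^ k" "2 ^ k < 2 * A"
    using power_nat_ceiling_log_bounds[of 2 A] A k by simp_all
  \<comment> \<open>The gradient rate starts at k = 1, because no poll has failed at x0; k = 0 would
    give \<open>A \<le> 1\<close>.\<close>
  have "1 \<le> k" using pow(1) A by (cases k) auto
  have fstar: "fstar \<le> f y" for y using H by (auto intro: cINF_lower)
  show prod: "sds_produces l k"
    using sds_produces_of_bounded_below assms fstar by blast
  have "norm (gradient f (sds_iterate x0 x l k)) \<le> K * \<alpha>0 / (\<mu> * 2 ^ k)"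
    using grad[OF \<open>1 \<le> k\<close> prod] by (simp add: K_def)
  \<comment> \<open>A is chosen so that putting it in place of \<open>2 ^ k\<close> gives exactly
    \<epsilon>.\<close>
  also have "\<dots> \<le> K * \<alpha>0 / (\<mu> * A)"
    using pow(1) A \<mu> K assms(8) by (intro divide_left_mono mult_left_mono) auto
  also have "\<dots> = \<epsilon>" using A \<mu> K assms(8) H by (simp add: A_def)
  finally show "norm (gradient f (sds_iterate x0 x l k)) \<le> \<epsilon>" .
  show "sds_evaluations l e k \<le> sds_evaluation_bound D l k"
    using sds_evaluations_le_bound assms prod by blast
  define S where "S = (\<Sum>j=1..k. real (the_enat (l j)))"
  have "S \<le> (f x0 - fstar) * (2 ^ k)\<^sup>2 / (c * \<alpha>0\<^sup>2)"
    unfolding S_def using sds_run_total_steps[OF assms(10) prod fstar assms(8,9)] .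
  also have "\<dots> \<le> (f x0 - fstar) * (2 * A)\<^sup>2 / (c * \<alpha>0\<^sup>2)"
    using pow(2) fstar[of x0] assms(9)
    by (intro divide_right_mono mult_left_mono power_mono) auto
  \<comment> \<open>The initial step size cancels; the 4 is the square of the rounding loss
    2.\<close>
  also have "\<dots> = 4 * ((f x0 - fstar) * K\<^sup>2 / (c * \<mu>\<^sup>2 * \<epsilon>\<^sup>2))"
    using assms(8) by (simp add: A_def power_mult_distrib power_divide mult_ac)
  \<comment> \<open>Weakens 4 to the stated constant; the other factor is nonnegative because
    \<open>fstar \<le> f x0\<close>.\<close>
  also have "\<dots> \<le> 16 / 3 * ((f x0 - fstar) * K\<^sup>2 / (c * \<mu>\<^sup>2 * \<epsilon>\<^sup>2))"
    using fstar[of x0] assms(9) by (intro mult_right_mono) auto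
  also have "\<dots> = 16 * (f x0 - fstar) * K\<^sup>2 / (3 * c * \<mu>\<^sup>2 * \<epsilon>\<^sup>2)"
    by (simp only: times_divide_times_eq mult.assoc)
  finally have S: "S \<le> 16 * (f x0 - fstar) * K\<^sup>2 / (3 * c * \<mu>\<^sup>2 * \<epsilon>\<^sup>2)" .
  \<comment> \<open>The summand k collects the one failed poll of each iteration, S the successful
    polls.\<close>
  have "real (sds_evaluation_bound D l k) = 1 + real (card D) * (real k + S)"
    by (simp add: sds_evaluation_bound_def S_def sum_distrib_left sum.distrib algebra_simps)
  also have "\<dots> \<le> 1 + real (card D) * (real k + 16 * (f x0 - fstar) * K\<^sup>2 / (3 * c * \<mu>\<^sup>2 * \<epsilon>\<^sup>2))"
    using S by (intro add_left_mono mult_left_mono) auto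
  finally show "real (sds_evaluation_bound D l k) \<le> 1 + real (card D) *
      (real k + 16 * (f x0 - fstar) * (L / 2 + c)\<^sup>2 / (3 * c * \<mu>\<^sup>2 * \<epsilon>\<^sup>2))"
    by (simp add: K_def)
qed

end
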